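(* For $\kappa>1$ and $\eta>0$ let $$s=s(\kappa,\eta)=\left\lceil\sqrt{(\kappa-1)\eta/2}\,\right\rceil,\qquad \alpha_s(\eta)=\frac{1}{T_s(1+\eta/s^2)},$$ where $T_s$ is the Chebyshev polynomial of the first kind of degree $s$, and let $c_{rkcd}(\kappa)=\alpha_s(\eta)^{2/s}$ (which depends on $\eta$) be the effective convergence rate of the Runge--Kutta Chebyshev descent method (RKCD) for minimising a strongly convex quadratic function $f(x)=\tfrac12x^TAx-b^Tx$ with condition number $\kappa$. Then $$\lim_{\eta\to\infty}c_{rkcd}(\kappa)=c_{opt}(\kappa)+O(\kappa^{-3/2}),\qquad c_{opt}(\kappa)=\left(\frac{\sqrt\kappa-1}{\sqrt\kappa+1}\right)^2,$$ where the $O(\kappa^{-3/2})$ is understood as $\kappa\to\infty$.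
   Context: Here $A\in\mathbb{R}^{d\times d}$ is symmetric positive definite with smallest and largest eigenvalues $\ell$ and $L$, $b\in\mathbb{R}^d$, and $\kappa=L/\ell$. $T_s$ is determined by $T_s(\cos\theta)=\cos(s\theta)$. RKCD with damping parameter $\eta>0$, number of internal stages $s$ and step size $h$: set $\omega_0=1+\eta/s^2$, $\omega_1=T_s(\omega_0)/T_s'(\omega_0)$, and take $s=\lceil\sqrt{(\kappa-1)\eta/2}\,\rceil$, $h=\frac{\omega_0-1}{\omega_1\ell}$. One iteration from $x_n$: $x_n^0=x_n$, $x_n^1=x_n-h\frac{\omega_1}{\omega_0}\nabla f(x_n)$, and for $j=2,\dots,s$, $x_n^j=-\mu_jh\nabla f(x_n^{j-1})+\nu_jx_n^{j-1}-(\nu_j-1)x_n^{j-2}$ with $\mu_j=2\omega_1T_{j-1}(\omega_0)/T_j(\omega_0)$, $\nu_j=2\omega_0T_{j-1}(\omega_0)/T_j(\omega_0)$; then $x_{n+1}=x_n^s$. One iteration uses $s$ gradient evaluations and satisfies $f(x_{n+1})-f(x_* )\le\alpha_s(\eta)^2(f(x_n)-f(x_* ))$, where $x_*$ is the minimiser of $f$; accordingly the effective convergence rate of RKCD is by definition $c_{rkcd}(\kappa)=\alpha_s(\eta)^{2/s}$ with $s=\lceil\sqrt{(\kappa-1)\eta/2}\,\rceil$. *)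

theory Defs
  imports
    Complex_Main
    "HOL-Computational_Algebra.Polynomial"
    "HOL-Library.Landau_Symbols"
begin

definition cheb_T :: "nat \<Rightarrow> real poly" where
  "cheb_T n = (THE p. \<forall>\<theta>. poly p (cos \<theta>) = cos (real n * \<theta>))"

lemma cheb_T_ex:
  "\<exists>p. \<forall>\<theta>. poly p (cos \<theta>) = cos (real n * \<theta>)"
proof (induction n rule: less_induct)
  case (less n)
  consider "n = 0" | "n = 1" | m where "n = Suc (Suc m)"
    by (cases n; cases "n - 1") auto
  then show ?case
  proof cases
    case 1
    then show ?thesis by (intro exI[of _ 1]) simp
  next
    case 2
    then show ?thesis by (intro exI[of _ "[:0, 1:]"]) simp
  next
    case (3 m)
    obtain p q where
      p: "\<And>\<theta>. poly p (cos \<theta>) = cos (real m * \<theta>)" and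
      q: "\<And>\<theta>. poly q (cos \<theta>) = cos (real (Suc m) * \<theta>)"
      using less[of m] less[of "Suc m"] 3 by auto
    have "poly ([:0, 2:] * q - p) (cos \<theta>) = cos (real n * \<theta>)" for \<theta>
    proof -
      have "cos (real n * \<theta>) = cos (real (Suc m) * \<theta> + \<theta>)"
        "cos (real m * \<theta>) = cos (real (Suc m) * \<theta> - \<theta>)"
        by (simp_all add: 3 distrib_right)
      then show ?thesis
        using p q by (simp add: cos_add cos_diff)
    qed
    then show ?thesis by blast
  qed
qed

lemma cheb_T_unique:
  assumes "\<forall>\<theta>. poly p (cos \<theta>) = cos (real n * \<theta>)"
    and "\<forall>\<theta>. poly q (cos \<theta>) = cos (real n * \<theta>)"
  shows "p = q"
proof (rule ccontr)
  assume "p \<noteq> q"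
  then have "finite {x. poly (p - q) x = 0}"
    by (intro poly_roots_finite) simp
  moreover have "{-1..1} \<subseteq> {x. poly (p - q) x = 0}"
  proof
    fix x :: real
    assume "x \<in> {-1..1}"
    then have "x = cos (arccos x)" by simp
    then show "x \<in> {x. poly (p - q) x = 0}"
      using assms[THEN spec, of "arccos x"] by simp
  qed
  ultimately have "finite {-1..1::real}" by (rule rev_finite_subset)
  then show False by (simp add: infinite_Icc)
qed

lemma cheb_T_cos: "poly (cheb_T n) (cos \<theta>) = cos (real n * \<theta>)"
proof -
  have "\<exists>!p. \<forall>\<theta>. poly p (cos \<theta>) = cos (real n * \<theta>)"
    using cheb_T_ex[of n] cheb_T_unique[of _ n] by auto
  from theI'[OF this] show ?thesis unfolding cheb_T_def by blast
qed

definition rkcd_stages :: "real \<Rightarrow> real \<Rightarrow> nat" where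
  "rkcd_stages \<kappa> \<eta> = nat \<lceil>sqrt ((\<kappa> - 1) * \<eta> / 2)\<rceil>"

definition rkcd_alpha :: "nat \<Rightarrow> real \<Rightarrow> real" where
  "rkcd_alpha s \<eta> = 1 / poly (cheb_T s) (1 + \<eta> / (real s)\<^sup>2)"

(* One iteration costs s gradient evaluations and contracts the objective gap
   by a factor alpha^2; c_rkcd is the resulting factor per gradient evaluation. *)
definition c_rkcd :: "real \<Rightarrow> real \<Rightarrow> real" where
  "c_rkcd \<kappa> \<eta> =
     rkcd_alpha (rkcd_stages \<kappa> \<eta>) \<eta> powr (2 / real (rkcd_stages \<kappa> \<eta>))"

definition c_opt :: "real \<Rightarrow> real" where
  "c_opt \<kappa> = ((sqrt \<kappa> - 1) / (sqrt \<kappa> + 1))\<^sup>2"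

end

(* Write 1 + eta/s^2 = (z + 1/z)/2 with z >= 1. Then T_s(1 + eta/s^2) = (z^s + z^(-s))/2 lies
   between z^s/2 and z^s, so alpha^(2/s) lies between z^(-2) and 2^(2/s) z^(-2). As eta tends to
   infinity, so does s, while eta/s^2 tends to 2/(kappa - 1), for which
   z = (sqrt kappa + 1)/(sqrt kappa - 1). Hence the limit is exactly c_opt, with zero error term. *)
theory Submission
  imports Defs
begin

lemma cheb_T_0: "cheb_T 0 = 1"
  by (rule cheb_T_unique[of _ 0]) (simp_all add: cheb_T_cos)

lemma cheb_T_1: "cheb_T (Suc 0) = [:0, 1:]"
  by (rule cheb_T_unique[of _ "Suc 0"]) (simp_all add: cheb_T_cos)

text \<open>Adding the formulas for cos((n+1)t + t) and cos((n+1)t - t) cancels the sines, so the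
  right-hand side passes the cosine test that characterises the polynomial uniquely.\<close>

lemma cheb_T_Suc_Suc: "cheb_T (Suc (Suc n)) = [:0, 2:] * cheb_T (Suc n) - cheb_T n"
proof (rule cheb_T_unique[of _ "Suc (Suc n)"])
  show "\<forall>\<theta>. poly ([:0, 2:] * cheb_T (Suc n) - cheb_T n) (cos \<theta>) = cos (real (Suc (Suc n)) * \<theta>)"
  proof
    fix \<theta> :: real
    have "cos (real (Suc (Suc n)) * \<theta>) = cos (real (Suc n) * \<theta> + \<theta>)"
      "cos (real n * \<theta>) = cos (real (Suc n) * \<theta> - \<theta>)"
      by (simp_all add: distrib_right)
    then show "poly ([:0, 2:] * cheb_T (Suc n) - cheb_T n) (cos \<theta>) = cos (real (Suc (Suc n)) * \<theta>)"
      by (simp add: cheb_T_cos cos_add cos_diff)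
  qed
qed (simp add: cheb_T_cos)

text \<open>The cosine identity only gives values on [-1, 1], whereas RKCD evaluates beyond 1. The
  recurrence is an identity of polynomials and so holds everywhere; z^n + z^(-n) obeys it too, with
  multiplier z + 1/z.\<close>

lemma cheb_T_joukowski:
  fixes z :: real
  assumes "z \<noteq> 0"
  shows "poly (cheb_T n) ((z + inverse z) / 2) = (z ^ n + inverse z ^ n) / 2"
proof (induction n rule: less_induct)
  case (less n)
  consider "n = 0" | "n = Suc 0" | m where "n = Suc (Suc m)"
    by (metis not0_implies_Suc)
  then show ?case
  proof cases
    case (3 m)
    define u where "u = inverse z"
    have zu: "z * u = 1" using assms by (simp add: u_def)
    \<comment> \<open>The mixed products each contain a factor \<open>z * u\<close>, kept visible
      here so that it can be replaced by 1.\<close>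
    have "(z + u) * (z ^ Suc m + u ^ Suc m) = z ^ n + u ^ n + (z * u) * (z ^ m + u ^ m)"
      by (simp add: 3 algebra_simps)
    then have step: "(z + u) * (z ^ Suc m + u ^ Suc m) - (z ^ m + u ^ m) = z ^ n + u ^ n"
      by (simp add: zu del: power_Suc)
    have IH: "poly (cheb_T m) ((z + u) / 2) = (z ^ m + u ^ m) / 2"
      "poly (cheb_T (Suc m)) ((z + u) / 2) = (z ^ Suc m + u ^ Suc m) / 2"
      using less[of m] less[of "Suc m"] by (simp_all add: 3 u_def)
    have "poly (cheb_T n) ((z + u) / 2)
        = (z + u) * poly (cheb_T (Suc m)) ((z + u) / 2) - poly (cheb_T m) ((z + u) / 2)"
      by (simp add: 3 cheb_T_Suc_Suc)
    also have "\<dots> = ((z + u) * (z ^ Suc m + u ^ Suc m) - (z ^ m + u ^ m)) / 2"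
      unfolding IH by (simp add: diff_divide_distrib del: power_Suc)
    also note step
    finally show ?thesis by (simp add: u_def)
  qed (simp_all add: cheb_T_0 cheb_T_1)
qed

text \<open>For w >= 1 this is the larger root of z^2 - 2wz + 1 = 0, that is, exp(arcosh w).\<close>

definition joukowski_inv :: "real \<Rightarrow> real" where
  "joukowski_inv w = w + sqrt (w\<^sup>2 - 1)"

lemma joukowski_inv:
  assumes "w \<ge> 1"
  shows "joukowski_inv w \<ge> 1" and "(joukowski_inv w + inverse (joukowski_inv w)) / 2 = w"
proof -
  have w2: "w\<^sup>2 \<ge> 1" using assms by simp
  then show ge1: "joukowski_inv w \<ge> 1"
    using assms by (simp add: joukowski_inv_def add_increasing2)
  \<comment> \<open>The conjugate root is the inverse, since the two roots have product 1.\<close>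
  have "joukowski_inv w * (w - sqrt (w\<^sup>2 - 1)) = w\<^sup>2 - (sqrt (w\<^sup>2 - 1))\<^sup>2"
    unfolding joukowski_inv_def by (simp add: power2_eq_square algebra_simps)
  also have "\<dots> = 1" using w2 by simp
  finally have "inverse (joukowski_inv w) = w - sqrt (w\<^sup>2 - 1)"
    by (rule inverse_unique)
  then show "(joukowski_inv w + inverse (joukowski_inv w)) / 2 = w"
    by (simp add: joukowski_inv_def)
qed

lemma cheb_T_bounds:
  assumes "w \<ge> 1"
  shows "joukowski_inv w ^ n / 2 \<le> poly (cheb_T n) w" "poly (cheb_T n) w \<le> joukowski_inv w ^ n"
proof -
  define z where "z = joukowski_inv w"
  have z: "z \<ge> 1" "(z + inverse z) / 2 = w"
    using joukowski_inv[OF assms] by (simp_all add: z_def)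
  have eq: "poly (cheb_T n) w = (z ^ n + inverse z ^ n) / 2"
    using cheb_T_joukowski[of z n] z by simp
  \<comment> \<open>The lower bound drops the second summand; the upper bound replaces it by the
    larger \<open>z ^ n\<close>.\<close>
  have "inverse z ^ n \<ge> 0" "inverse z ^ n \<le> 1" "1 \<le> z ^ n"
    using z by (auto intro!: power_le_one simp: inverse_le_1_iff)
  then show "joukowski_inv w ^ n / 2 \<le> poly (cheb_T n) w"
    "poly (cheb_T n) w \<le> joukowski_inv w ^ n"
    unfolding eq z_def[symmetric] by simp_all
qed

text \<open>The exponent 2/s undoes the s-th power of z, and it turns the constant 2 lost in the
  crude bound on T_s into 2^(2/s), which tends to 1 as s grows.\<close>

lemma rkcd_alpha_powr_bounds:
  assumes "\<eta> \<ge> 0" "s > 0"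
  defines "z \<equiv> joukowski_inv (1 + \<eta> / (real s)\<^sup>2)"
  shows "inverse (z\<^sup>2) \<le> rkcd_alpha s \<eta> powr (2 / real s)"
    and "rkcd_alpha s \<eta> powr (2 / real s) \<le> 2 powr (2 / real s) * inverse (z\<^sup>2)"
proof -
  have w: "1 + \<eta> / (real s)\<^sup>2 \<ge> 1" using assms by simp
  have z: "z \<ge> 1" using joukowski_inv[OF w] by (simp add: z_def)
  have zs: "z ^ s > 0" using z by simp
  note T = cheb_T_bounds[OF w, of s, folded z_def]
  have "inverse (z ^ s) powr (2 / real s) = (z powr (- real s)) powr (2 / real s)"
    using z by (simp add: powr_minus powr_realpow)
  also have "\<dots> = z powr - 2"
    using assms by (simp add: powr_powr)
  also have "\<dots> = inverse (z\<^sup>2)"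
    using z by (simp add: powr_minus powr_realpow[of z 2, simplified])
  finally have eq: "inverse (z ^ s) powr (2 / real s) = inverse (z\<^sup>2)" .
  have lower: "inverse (z ^ s) \<le> rkcd_alpha s \<eta>"
    unfolding rkcd_alpha_def using T zs by (simp add: inverse_eq_divide frac_le)
  then show "inverse (z\<^sup>2) \<le> rkcd_alpha s \<eta> powr (2 / real s)"
    unfolding eq[symmetric] using zs by (intro powr_mono2) auto
  have "rkcd_alpha s \<eta> \<le> 1 / (z ^ s / 2)"
    unfolding rkcd_alpha_def using T(1) zs by (intro frac_le) auto
  also have "\<dots> = 2 * inverse (z ^ s)"
    by (simp add: inverse_eq_divide)
  finally have upper: "rkcd_alpha s \<eta> \<le> 2 * inverse (z ^ s)" .
  \<comment> \<open>Monotonicity of \<open>powr\<close> needs a nonnegative base; for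
    \<open>rkcd_alpha\<close> this follows from \<open>lower\<close>.\<close>
  have "0 \<le> inverse (z ^ s)" using zs by simp
  then have "rkcd_alpha s \<eta> powr (2 / real s) \<le> (2 * inverse (z ^ s)) powr (2 / real s)"
    using order_trans[OF _ lower] upper by (intro powr_mono2) simp_all
  also have "\<dots> = 2 powr (2 / real s) * inverse (z\<^sup>2)"
    unfolding eq[symmetric] by (rule powr_mult)
  finally show "rkcd_alpha s \<eta> powr (2 / real s) \<le> 2 powr (2 / real s) * inverse (z\<^sup>2)" .
qed

lemma filterlim_rkcd_stages:
  assumes "\<kappa> > 1"
  shows "filterlim (\<lambda>\<eta>. real (rkcd_stages \<kappa> \<eta>)) at_top at_top"
proof (rule filterlim_at_top_mono)
  have "filterlim (\<lambda>\<eta>::real. ((\<kappa> - 1) / 2) * \<eta>) at_top at_top"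
    using assms by (intro filterlim_tendsto_pos_mult_at_top[OF tendsto_const] filterlim_ident) auto
  then show "filterlim (\<lambda>\<eta>. sqrt ((\<kappa> - 1) * \<eta> / 2)) at_top at_top"
    by (intro filterlim_compose[OF sqrt_at_top]) simp
  show "\<forall>\<^sub>F \<eta> in at_top. sqrt ((\<kappa> - 1) * \<eta> / 2) \<le> real (rkcd_stages \<kappa> \<eta>)"
    unfolding rkcd_stages_def by (intro always_eventually allI real_nat_ceiling_ge)
qed

text \<open>Rounding up moves the square root y by less than 1, which is negligible against s, so
  y/s tends to 1. For eta >= 0 the quotient is (y/s)^2 times 2/(kappa - 1).\<close>

lemma tendsto_rkcd_damping:
  assumes "\<kappa> > 1"
  shows "((\<lambda>\<eta>. \<eta> / (real (rkcd_stages \<kappa> \<eta>))\<^sup>2) \<longlongrightarrow> 2 / (\<kappa> - 1)) at_top"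
proof -
  define s where "s \<eta> = real (rkcd_stages \<kappa> \<eta>)" for \<eta>
  define y where "y \<eta> = sqrt ((\<kappa> - 1) * \<eta> / 2)" for \<eta>
  have s_top: "filterlim s at_top at_top"
    using filterlim_rkcd_stages[OF assms] by (simp add: s_def[abs_def])
  have ys: "((\<lambda>\<eta>. y \<eta> / s \<eta>) \<longlongrightarrow> 1) at_top"
  proof (rule tendsto_sandwich)
    show "((\<lambda>\<eta>. 1 - inverse (s \<eta>)) \<longlongrightarrow> 1) at_top"
      using tendsto_diff[OF tendsto_const[of 1] tendsto_inverse_0_at_top[OF s_top]] by simp
    show "\<forall>\<^sub>F \<eta> in at_top. y \<eta> / s \<eta> \<le> 1"
    proof (intro always_eventually allI)
      fix \<eta>
      have "y \<eta> \<le> s \<eta>" "s \<eta> \<ge> 0"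
        unfolding s_def y_def rkcd_stages_def by (simp_all only: real_nat_ceiling_ge of_nat_0_le_iff)
      \<comment> \<open>No eta has to be excluded: where \<open>s \<eta>\<close> is 0, the quotient
        is 0 by convention.\<close>
      then show "y \<eta> / s \<eta> \<le> 1" by (auto simp: divide_le_eq_1)
    qed
    show "\<forall>\<^sub>F \<eta> in at_top. 1 - inverse (s \<eta>) \<le> y \<eta> / s \<eta>"
      using filterlim_at_top_dense[THEN iffD1, rule_format, OF s_top, of 0]
        eventually_ge_at_top[of 0]
    proof eventually_elim
      case (elim \<eta>)
      \<comment> \<open>The sign matters because \<open>nat\<close> sends negative integers to 0,
        which could exceed \<open>y \<eta> + 1\<close>.\<close>
      then have "y \<eta> \<ge> 0" using assms by (simp add: y_def)
      then have "s \<eta> \<le> y \<eta> + 1"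
        unfolding s_def rkcd_stages_def y_def[symmetric] by linarith
      then have "(s \<eta> - 1) / s \<eta> \<le> y \<eta> / s \<eta>"
        using elim by (intro divide_right_mono) auto
      then show ?case using elim by (simp add: diff_divide_distrib inverse_eq_divide)
    qed
  qed simp
  have "((\<lambda>\<eta>. 2 / (\<kappa> - 1) * (y \<eta> / s \<eta>)\<^sup>2) \<longlongrightarrow> 2 / (\<kappa> - 1) * 1\<^sup>2) at_top"
    by (intro tendsto_intros ys)
  moreover have "\<forall>\<^sub>F \<eta> in at_top. 2 / (\<kappa> - 1) * (y \<eta> / s \<eta>)\<^sup>2 = \<eta> / (s \<eta>)\<^sup>2"
    using eventually_ge_at_top[of 0]
  proof eventually_elim
    case (elim \<eta>)
    then have "(y \<eta>)\<^sup>2 = (\<kappa> - 1) * \<eta> / 2" using assms by (simp add: y_def)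
    then have "2 / (\<kappa> - 1) * (y \<eta>)\<^sup>2 = \<eta>"
      using assms by (simp add: divide_eq_eq mult.commute)
    then show ?case by (metis power_divide times_divide_eq_right)
  qed
  ultimately show ?thesis
    unfolding s_def by (simp add: filterlim_cong)
qed

text \<open>Here w = (kappa + 1)/(kappa - 1), and (kappa + 1)^2 - (kappa - 1)^2 = 4 kappa makes w^2
  - 1 a perfect square in terms of r = sqrt kappa.\<close>

lemma inverse_joukowski_inv_sq_eq_c_opt:
  assumes "\<kappa> > 1"
  shows "inverse ((joukowski_inv (1 + 2 / (\<kappa> - 1)))\<^sup>2) = c_opt \<kappa>"
proof -
  define r where "r = sqrt \<kappa>"
  have r: "r > 1" "\<kappa> = r\<^sup>2" using assms by (simp_all add: r_def)
  have r2: "r\<^sup>2 - 1 > 0" using assms r by simp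
  have "(1 + 2 / (\<kappa> - 1))\<^sup>2 - 1 = (2 * r / (r\<^sup>2 - 1))\<^sup>2"
    using r2 unfolding r(2) by (simp add: divide_simps) (simp add: power2_eq_square algebra_simps)
  then have "joukowski_inv (1 + 2 / (\<kappa> - 1)) = 1 + 2 / (r\<^sup>2 - 1) + 2 * r / (r\<^sup>2 - 1)"
    using r r2 by (simp add: joukowski_inv_def)
  also have "\<dots> = (r + 1)\<^sup>2 / (r\<^sup>2 - 1)"
    using r2 by (simp add: divide_simps) (simp add: power2_eq_square algebra_simps)
  also have "r\<^sup>2 - 1 = (r - 1) * (r + 1)"
    by (simp add: power2_eq_square algebra_simps)
  also have "(r + 1)\<^sup>2 / ((r - 1) * (r + 1)) = (r + 1) / (r - 1)"
    using r by (simp add: power2_eq_square)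
  finally show ?thesis
    by (simp add: c_opt_def r_def power_divide)
qed

lemma tendsto_c_rkcd:
  assumes "\<kappa> > 1"
  shows "((\<lambda>\<eta>. c_rkcd \<kappa> \<eta>) \<longlongrightarrow> c_opt \<kappa>) at_top"
proof -
  define s where "s = rkcd_stages \<kappa>"
  define q where "q \<eta> = inverse ((joukowski_inv (1 + \<eta> / (real (s \<eta>))\<^sup>2))\<^sup>2)" for \<eta>
  have s_top: "filterlim (\<lambda>\<eta>. real (s \<eta>)) at_top at_top"
    using filterlim_rkcd_stages[OF assms] by (simp add: s_def)
  \<comment> \<open>This keeps the limit of the denominator away from 0, as continuity of
    \<open>inverse\<close> requires.\<close>
  have "joukowski_inv (1 + 2 / (\<kappa> - 1)) \<ge> 1"
    using assms by (intro joukowski_inv) simp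
  then have q: "(q \<longlongrightarrow> c_opt \<kappa>) at_top"
    unfolding inverse_joukowski_inv_sq_eq_c_opt[OF assms, symmetric] q_def s_def joukowski_inv_def
    by (intro tendsto_intros tendsto_rkcd_damping[OF assms]) auto
  \<comment> \<open>The exponent is written as a product so that its limit 0 comes from
    \<open>s_top\<close>.\<close>
  have "((\<lambda>\<eta>. 2 powr (2 * inverse (real (s \<eta>))) * q \<eta>) \<longlongrightarrow> 2 powr (2 * 0) * c_opt \<kappa>) at_top"
    by (intro tendsto_intros q tendsto_inverse_0_at_top[OF s_top]) auto
  then have u: "((\<lambda>\<eta>. 2 powr (2 / real (s \<eta>)) * q \<eta>) \<longlongrightarrow> c_opt \<kappa>) at_top"
    by (simp add: divide_inverse)
  have ev: "\<forall>\<^sub>F \<eta> in at_top. \<eta> \<ge> 0 \<and> s \<eta> > 0"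
    using filterlim_at_top_dense[THEN iffD1, rule_format, OF s_top, of 0]
      eventually_ge_at_top[of 0]
    by eventually_elim simp
  show ?thesis
  proof (rule tendsto_sandwich[OF _ _ q u])
    show "\<forall>\<^sub>F \<eta> in at_top. q \<eta> \<le> c_rkcd \<kappa> \<eta>"
      using ev by eventually_elim (simp add: c_rkcd_def q_def rkcd_alpha_powr_bounds flip: s_def)
    show "\<forall>\<^sub>F \<eta> in at_top. c_rkcd \<kappa> \<eta> \<le> 2 powr (2 / real (s \<eta>)) * q \<eta>"
      using ev by eventually_elim (simp add: c_rkcd_def q_def rkcd_alpha_powr_bounds flip: s_def)
  qed
qed

theorem proposition2:
  shows "\<exists>C :: real \<Rightarrow> real.
    (\<forall>\<kappa>>1. ((\<lambda>\<eta>. c_rkcd \<kappa> \<eta>) \<longlongrightarrow> C \<kappa>) at_top) \<and>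
    (\<lambda>\<kappa>. C \<kappa> - c_opt \<kappa>) \<in> O[at_top](\<lambda>\<kappa>. \<kappa> powr (-3/2))"
  \<comment> \<open>With this witness the difference is the zero function, a member of every
    O-class.\<close>
  by (intro exI[of _ c_opt]) (simp add: tendsto_c_rkcd)

end
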